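(* Let $k$ be a commutative ring and let $\mathcal{T}$ be a triangulated $k$-category. The following assertions hold: (1) If $M\leq_{\Delta,\mathrm{left}}N$ (resp. $M\leq_{\Delta+\mathrm{nil},\mathrm{left}}N$) via a distinguished triangle $$Z\xrightarrow{\begin{pmatrix}u\\ v\end{pmatrix}}M\oplus Z\xrightarrow{(\pi\ \ \tau)}N\xrightarrow{\mu}Z[1],$$ where $v$ is a nilpotent endomorphism in the case of $\leq_{\Delta+\mathrm{nil},\mathrm{left}}$, then $0\leq_{\Delta,\mathrm{left}}\mathrm{cone}(\pi)\simeq\mathrm{cone}(v)$ (resp. $0\leq_{\Delta+\mathrm{nil},\mathrm{left}}\mathrm{cone}(\pi)\simeq\mathrm{cone}(v)$). (2) If $M\leq_{\Delta,\mathrm{right}}N$ (resp. $M\leq_{\Delta+\mathrm{nil},\mathrm{right}}N$) via a distinguished triangle $$N\xrightarrow{\begin{pmatrix}\sigma\\ \lambda\end{pmatrix}}M\oplus Z'\xrightarrow{(u'\ \ v')}Z'\xrightarrow{\mu'}N[1],$$ where $v'$ is a nilpotent endomorphism in the case of $\leq_{\Delta+\mathrm{nil},\mathrm{right}}$, then $0\leq_{\Delta,\mathrm{right}}\mathrm{cone}(\sigma)\simeq\mathrm{cone}(v')$ (resp. $0\leq_{\Delta+\mathrm{nil},\mathrm{right}}\mathrm{cone}(\sigma)\simeq\mathrm{cone}(v')$). On the other hand, if $C$ is the cone of an endomorphism (resp. a nilpotent endomorphism) $v$ of an object $Z$ of $\mathcal{T}$, then for every object $M$ and every morphism $u:M\to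 Z$, the homotopy pullback of $M\xrightarrow{u}Z\xleftarrow{v}Z$ gives an object $N$ such that $M\leq_{\Delta,\mathrm{right}}N$ (resp. $M\leq_{\Delta+\mathrm{nil},\mathrm{right}}N$ when $v$ is nilpotent). Similarly, for every morphism $u':Z\to M$, the homotopy pushout of $M\xleftarrow{u'}Z\xrightarrow{v}Z$ gives an object $N$ such that $M\leq_{\Delta,\mathrm{left}}N$ (resp. $M\leq_{\Delta+\mathrm{nil},\mathrm{left}}N$ when $v$ is nilpotent).
   Context: For objects $M,N$ of a triangulated category $\mathcal{T}$ with shift $[1]$: $M\leq_{\Delta,\mathrm{left}}N$ means that there are an object $Z$ and a distinguished triangle $Z\xrightarrow{\begin{pmatrix}v\\ u\end{pmatrix}}Z\oplus M\to N\to Z[1]$; $M\leq_{\Delta+\mathrm{nil},\mathrm{left}}N$ means that there is such a triangle with the endomorphism $v$ of $Z$ nilpotent. Similarly, $M\leq_{\Delta,\mathrm{right}}N$ means that there are an object $Z'$ and a distinguished triangle $N\to Z'\oplus M\xrightarrow{(v',u')}Z'\to N[1]$, and $M\leq_{\Delta+\mathrm{nil},\mathrm{right}}N$ means that there is such a triangle with the endomorphism $v'$ of $Z'$ nilpotent. A commutative square with morphisms $f:A\to B$, $g:A\to C$, $f':C\to D$, $g':B\to D$ (so $g'f=f'g$) is homotopy cartesian if there is a distinguished triangle $A\xrightarrow{\begin{pmatrix}g\\ -f\end{pmatrix}}C\oplus B\xrightarrow{(f'\ \ g')}D\to A[1]$. In this case $A$ (with $f,g$) is a homotopy pullback of $B\xrightarrow{g'}D\xleftarrow{f'}C$,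 and $D$ (with $f',g'$) is a homotopy pushout of $B\xleftarrow{f}A\xrightarrow{g}C$. Homotopy pullbacks and pushouts exist and are unique up to non-unique isomorphism. *)

theory Defs
  imports "HOL-Algebra.Module"
begin

(* Each hom-set is a module over the base ring in the sense of HOL-Algebra; the multiplication
   and unit fields of that record carry no information here.  Hom-sets between different pairs of
   objects are required to be disjoint (see klinear_category), so composition and the action of
   the shift on morphisms need no object arguments. *)
record ('k, 'o, 'm) klin_cat =
  Ob :: "'o set"
  Hom :: "'o \<Rightarrow> 'o \<Rightarrow> ('k, 'm) module"
  comp :: "'m \<Rightarrow> 'm \<Rightarrow> 'm"  (infixr "\<cdot>\<index>" 75)
  ident :: "'o \<Rightarrow> 'm"

abbreviation mor :: "('k, 'o, 'm, 's) klin_cat_scheme \<Rightarrow> 'o \<Rightarrow> 'o \<Rightarrow> 'm set" where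
  "mor T X Y \<equiv> carrier (Hom T X Y)"

locale klinear_category =
  fixes k :: "('k, 'r) ring_scheme" and T :: "('k, 'o, 'm, 's) klin_cat_scheme"
  assumes base_ring: "cring k"
    and hom_module: "\<lbrakk>X \<in> Ob T; Y \<in> Ob T\<rbrakk> \<Longrightarrow> module k (Hom T X Y)"
    and hom_disjoint: "\<lbrakk>X \<in> Ob T; Y \<in> Ob T; X' \<in> Ob T; Y' \<in> Ob T; f \<in> mor T X Y; f \<in> mor T X' Y'\<rbrakk>
          \<Longrightarrow> X = X' \<and> Y = Y'"
    and ident_closed: "X \<in> Ob T \<Longrightarrow> ident T X \<in> mor T X X"
    and comp_closed: "\<lbrakk>X \<in> Ob T; Y \<in> Ob T; Z \<in> Ob T; f \<in> mor T X Y; g \<in> mor T Y Z\<rbrakk>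
          \<Longrightarrow> g \<cdot>\<^bsub>T\<^esub> f \<in> mor T X Z"
    and ident_left: "\<lbrakk>X \<in> Ob T; Y \<in> Ob T; f \<in> mor T X Y\<rbrakk> \<Longrightarrow> ident T Y \<cdot>\<^bsub>T\<^esub> f = f"
    and ident_right: "\<lbrakk>X \<in> Ob T; Y \<in> Ob T; f \<in> mor T X Y\<rbrakk> \<Longrightarrow> f \<cdot>\<^bsub>T\<^esub> ident T X = f"
    and comp_assoc: "\<lbrakk>W \<in> Ob T; X \<in> Ob T; Y \<in> Ob T; Z \<in> Ob T;
            f \<in> mor T W X; g \<in> mor T X Y; h \<in> mor T Y Z\<rbrakk>
          \<Longrightarrow> (h \<cdot>\<^bsub>T\<^esub> g) \<cdot>\<^bsub>T\<^esub> f = h \<cdot>\<^bsub>T\<^esub> (g \<cdot>\<^bsub>T\<^esub> f)"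
    and comp_add_left: "\<lbrakk>X \<in> Ob T; Y \<in> Ob T; Z \<in> Ob T; f \<in> mor T X Y; g \<in> mor T Y Z; h \<in> mor T Y Z\<rbrakk>
          \<Longrightarrow> (g \<oplus>\<^bsub>Hom T Y Z\<^esub> h) \<cdot>\<^bsub>T\<^esub> f = (g \<cdot>\<^bsub>T\<^esub> f) \<oplus>\<^bsub>Hom T X Z\<^esub> (h \<cdot>\<^bsub>T\<^esub> f)"
    and comp_add_right: "\<lbrakk>X \<in> Ob T; Y \<in> Ob T; Z \<in> Ob T; f \<in> mor T X Y; g \<in> mor T X Y; h \<in> mor T Y Z\<rbrakk>
          \<Longrightarrow> h \<cdot>\<^bsub>T\<^esub> (f \<oplus>\<^bsub>Hom T X Y\<^esub> g) = (h \<cdot>\<^bsub>T\<^esub> f) \<oplus>\<^bsub>Hom T X Z\<^esub> (h \<cdot>\<^bsub>T\<^esub> g)"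
    and comp_smult_left: "\<lbrakk>X \<in> Ob T; Y \<in> Ob T; Z \<in> Ob T; \<kappa> \<in> carrier k; f \<in> mor T X Y; g \<in> mor T Y Z\<rbrakk>
          \<Longrightarrow> (\<kappa> \<odot>\<^bsub>Hom T Y Z\<^esub> g) \<cdot>\<^bsub>T\<^esub> f = \<kappa> \<odot>\<^bsub>Hom T X Z\<^esub> (g \<cdot>\<^bsub>T\<^esub> f)"
    and comp_smult_right: "\<lbrakk>X \<in> Ob T; Y \<in> Ob T; Z \<in> Ob T; \<kappa> \<in> carrier k; f \<in> mor T X Y; g \<in> mor T Y Z\<rbrakk>
          \<Longrightarrow> g \<cdot>\<^bsub>T\<^esub> (\<kappa> \<odot>\<^bsub>Hom T X Y\<^esub> f) = \<kappa> \<odot>\<^bsub>Hom T X Z\<^esub> (g \<cdot>\<^bsub>T\<^esub> f)"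

definition is_iso :: "('k, 'o, 'm, 's) klin_cat_scheme \<Rightarrow> 'o \<Rightarrow> 'o \<Rightarrow> 'm \<Rightarrow> bool" where
  "is_iso T X Y f \<longleftrightarrow> X \<in> Ob T \<and> Y \<in> Ob T \<and> f \<in> mor T X Y \<and>
     (\<exists>g\<in>mor T Y X. g \<cdot>\<^bsub>T\<^esub> f = ident T X \<and> f \<cdot>\<^bsub>T\<^esub> g = ident T Y)"

definition isomorphic :: "('k, 'o, 'm, 's) klin_cat_scheme \<Rightarrow> 'o \<Rightarrow> 'o \<Rightarrow> bool" where
  "isomorphic T X Y \<longleftrightarrow> (\<exists>f. is_iso T X Y f)"

definition zero_object :: "('k, 'o, 'm, 's) klin_cat_scheme \<Rightarrow> 'o \<Rightarrow> bool" where
  "zero_object T O0 \<longleftrightarrow> O0 \<in> Ob T \<and>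
     (\<forall>X\<in>Ob T. (\<exists>!f. f \<in> mor T O0 X) \<and> (\<exists>!f. f \<in> mor T X O0))"

record ('o, 'm) biprod =
  sum_ob :: 'o
  in1 :: 'm
  in2 :: 'm
  pr1 :: 'm
  pr2 :: 'm

definition is_biprod :: "('k, 'o, 'm, 's) klin_cat_scheme \<Rightarrow> 'o \<Rightarrow> 'o \<Rightarrow> ('o, 'm) biprod \<Rightarrow> bool" where
  "is_biprod T A B S \<longleftrightarrow> A \<in> Ob T \<and> B \<in> Ob T \<and> sum_ob S \<in> Ob T \<and>
     in1 S \<in> mor T A (sum_ob S) \<and> in2 S \<in> mor T B (sum_ob S) \<and>
     pr1 S \<in> mor T (sum_ob S) A \<and> pr2 S \<in> mor T (sum_ob S) B \<and>
     pr1 S \<cdot>\<^bsub>T\<^esub> in1 S = ident T A \<and> pr2 S \<cdot>\<^bsub>T\<^esub> in2 S = ident T B \<and>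
     pr1 S \<cdot>\<^bsub>T\<^esub> in2 S = \<zero>\<^bsub>Hom T B A\<^esub> \<and> pr2 S \<cdot>\<^bsub>T\<^esub> in1 S = \<zero>\<^bsub>Hom T A B\<^esub> \<and>
     (in1 S \<cdot>\<^bsub>T\<^esub> pr1 S) \<oplus>\<^bsub>Hom T (sum_ob S) (sum_ob S)\<^esub> (in2 S \<cdot>\<^bsub>T\<^esub> pr2 S) = ident T (sum_ob S)"

(* The column with entries a : X \<rightarrow> A and b : X \<rightarrow> B, as a morphism X \<rightarrow> A \<oplus> B. *)
definition col_mor :: "('k, 'o, 'm, 's) klin_cat_scheme \<Rightarrow> 'o \<Rightarrow> ('o, 'm) biprod \<Rightarrow> 'm \<Rightarrow> 'm \<Rightarrow> 'm" where
  "col_mor T X S a b = (in1 S \<cdot>\<^bsub>T\<^esub> a) \<oplus>\<^bsub>Hom T X (sum_ob S)\<^esub> (in2 S \<cdot>\<^bsub>T\<^esub> b)"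

(* The row with entries a : A \<rightarrow> Y and b : B \<rightarrow> Y, as a morphism A \<oplus> B \<rightarrow> Y. *)
definition row_mor :: "('k, 'o, 'm, 's) klin_cat_scheme \<Rightarrow> ('o, 'm) biprod \<Rightarrow> 'o \<Rightarrow> 'm \<Rightarrow> 'm \<Rightarrow> 'm" where
  "row_mor T S Y a b = (a \<cdot>\<^bsub>T\<^esub> pr1 S) \<oplus>\<^bsub>Hom T (sum_ob S) Y\<^esub> (b \<cdot>\<^bsub>T\<^esub> pr2 S)"

primrec endo_pow :: "('k, 'o, 'm, 's) klin_cat_scheme \<Rightarrow> 'o \<Rightarrow> 'm \<Rightarrow> nat \<Rightarrow> 'm" where
  "endo_pow T Z v 0 = ident T Z"
| "endo_pow T Z v (Suc n) = v \<cdot>\<^bsub>T\<^esub> endo_pow T Z v n"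

definition nilpotent_endo :: "('k, 'o, 'm, 's) klin_cat_scheme \<Rightarrow> 'o \<Rightarrow> 'm \<Rightarrow> bool" where
  "nilpotent_endo T Z v \<longleftrightarrow> v \<in> mor T Z Z \<and> (\<exists>n. endo_pow T Z v n = \<zero>\<^bsub>Hom T Z Z\<^esub>)"

locale additive_klinear_category = klinear_category +
  assumes zero_object_exists: "\<exists>O0. zero_object T O0"
    and biprod_exists: "\<lbrakk>A \<in> Ob T; B \<in> Ob T\<rbrakk> \<Longrightarrow> \<exists>S. is_biprod T A B S"

(* dist T X Y Z f g h: the triangle X -f-> Y -g-> Z -h-> X[1] is distinguished. *)
record ('k, 'o, 'm) tri_cat = "('k, 'o, 'm) klin_cat" +
  sh :: "'o \<Rightarrow> 'o"
  shm :: "'m \<Rightarrow> 'm"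
  dist :: "'o \<Rightarrow> 'o \<Rightarrow> 'o \<Rightarrow> 'm \<Rightarrow> 'm \<Rightarrow> 'm \<Rightarrow> bool"

(* Verdier's axioms, with the shift a k-linear autoequivalence (fully faithful and essentially
   surjective); it need not be strictly invertible. *)
locale triangulated_kcategory = additive_klinear_category k T
  for k :: "('k, 'r) ring_scheme" and T :: "('k, 'o, 'm, 's) tri_cat_scheme" +
  assumes sh_closed: "X \<in> Ob T \<Longrightarrow> sh T X \<in> Ob T"
    and sh_full_faithful: "\<lbrakk>X \<in> Ob T; Y \<in> Ob T\<rbrakk>
          \<Longrightarrow> bij_betw (shm T) (mor T X Y) (mor T (sh T X) (sh T Y))"
    and sh_ess_surj: "Y \<in> Ob T \<Longrightarrow> \<exists>X\<in>Ob T. isomorphic T (sh T X) Y"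
    and shm_ident: "X \<in> Ob T \<Longrightarrow> shm T (ident T X) = ident T (sh T X)"
    and shm_comp: "\<lbrakk>X \<in> Ob T; Y \<in> Ob T; Z \<in> Ob T; f \<in> mor T X Y; g \<in> mor T Y Z\<rbrakk>
          \<Longrightarrow> shm T (g \<cdot>\<^bsub>T\<^esub> f) = shm T g \<cdot>\<^bsub>T\<^esub> shm T f"
    and shm_add: "\<lbrakk>X \<in> Ob T; Y \<in> Ob T; f \<in> mor T X Y; g \<in> mor T X Y\<rbrakk>
          \<Longrightarrow> shm T (f \<oplus>\<^bsub>Hom T X Y\<^esub> g) = shm T f \<oplus>\<^bsub>Hom T (sh T X) (sh T Y)\<^esub> shm T g"
    and shm_smult: "\<lbrakk>X \<in> Ob T; Y \<in> Ob T; \<kappa> \<in> carrier k; f \<in> mor T X Y\<rbrakk>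
          \<Longrightarrow> shm T (\<kappa> \<odot>\<^bsub>Hom T X Y\<^esub> f) = \<kappa> \<odot>\<^bsub>Hom T (sh T X) (sh T Y)\<^esub> shm T f"
    and dist_typed: "dist T X Y Z f g h \<Longrightarrow> X \<in> Ob T \<and> Y \<in> Ob T \<and> Z \<in> Ob T \<and>
          f \<in> mor T X Y \<and> g \<in> mor T Y Z \<and> h \<in> mor T Z (sh T X)"
    and TR1_iso: "\<lbrakk>dist T X Y Z f g h; is_iso T X X' a; is_iso T Y Y' b; is_iso T Z Z' c;
            f' \<in> mor T X' Y'; g' \<in> mor T Y' Z'; h' \<in> mor T Z' (sh T X');
            b \<cdot>\<^bsub>T\<^esub> f = f' \<cdot>\<^bsub>T\<^esub> a; c \<cdot>\<^bsub>T\<^esub> g = g' \<cdot>\<^bsub>T\<^esub> b; shm T a \<cdot>\<^bsub>T\<^esub> h = h' \<cdot>\<^bsub>T\<^esub> c\<rbrakk>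
          \<Longrightarrow> dist T X' Y' Z' f' g' h'"
    and TR1_ident: "\<lbrakk>X \<in> Ob T; zero_object T O0\<rbrakk>
          \<Longrightarrow> dist T X X O0 (ident T X) \<zero>\<^bsub>Hom T X O0\<^esub> \<zero>\<^bsub>Hom T O0 (sh T X)\<^esub>"
    and TR1_cone: "\<lbrakk>X \<in> Ob T; Y \<in> Ob T; f \<in> mor T X Y\<rbrakk> \<Longrightarrow> \<exists>Z g h. dist T X Y Z f g h"
    and TR2: "\<lbrakk>X \<in> Ob T; Y \<in> Ob T; Z \<in> Ob T; f \<in> mor T X Y; g \<in> mor T Y Z; h \<in> mor T Z (sh T X)\<rbrakk>
          \<Longrightarrow> dist T X Y Z f g h \<longleftrightarrow>
             dist T Y Z (sh T X) g h (\<ominus>\<^bsub>Hom T (sh T X) (sh T Y)\<^esub> shm T f)"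
    and TR3: "\<lbrakk>dist T X Y Z f g h; dist T X' Y' Z' f' g' h';
            a \<in> mor T X X'; b \<in> mor T Y Y'; b \<cdot>\<^bsub>T\<^esub> f = f' \<cdot>\<^bsub>T\<^esub> a\<rbrakk>
          \<Longrightarrow> \<exists>c\<in>mor T Z Z'. c \<cdot>\<^bsub>T\<^esub> g = g' \<cdot>\<^bsub>T\<^esub> b \<and> shm T a \<cdot>\<^bsub>T\<^esub> h = h' \<cdot>\<^bsub>T\<^esub> c"
    and TR4: "\<lbrakk>dist T X Y Cf f a a'; dist T Y Z Cg g b b'; dist T X Z Cgf (g \<cdot>\<^bsub>T\<^esub> f) c c'\<rbrakk>
          \<Longrightarrow> \<exists>r s. dist T Cf Cgf Cg r s (shm T a \<cdot>\<^bsub>T\<^esub> b') \<and>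
                r \<cdot>\<^bsub>T\<^esub> a = c \<cdot>\<^bsub>T\<^esub> g \<and> c' \<cdot>\<^bsub>T\<^esub> r = a' \<and>
                s \<cdot>\<^bsub>T\<^esub> c = b \<and> b' \<cdot>\<^bsub>T\<^esub> s = shm T f \<cdot>\<^bsub>T\<^esub> c'"

(* Cones are determined only up to isomorphism, hence a predicate. *)
definition is_cone :: "('k, 'o, 'm, 's) tri_cat_scheme \<Rightarrow> 'o \<Rightarrow> 'o \<Rightarrow> 'm \<Rightarrow> 'o \<Rightarrow> bool" where
  "is_cone T X Y f C \<longleftrightarrow> (\<exists>g h. dist T X Y C f g h)"

definition le_left :: "('k, 'o, 'm, 's) tri_cat_scheme \<Rightarrow> 'o \<Rightarrow> 'o \<Rightarrow> bool" where
  "le_left T M N \<longleftrightarrow> (\<exists>Z S v u g h. is_biprod T Z M S \<and> v \<in> mor T Z Z \<and> u \<in> mor T Z M \<and>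
     dist T Z (sum_ob S) N (col_mor T Z S v u) g h)"

definition le_nil_left :: "('k, 'o, 'm, 's) tri_cat_scheme \<Rightarrow> 'o \<Rightarrow> 'o \<Rightarrow> bool" where
  "le_nil_left T M N \<longleftrightarrow> (\<exists>Z S v u g h. is_biprod T Z M S \<and> v \<in> mor T Z Z \<and> u \<in> mor T Z M \<and>
     dist T Z (sum_ob S) N (col_mor T Z S v u) g h \<and> nilpotent_endo T Z v)"

definition le_right :: "('k, 'o, 'm, 's) tri_cat_scheme \<Rightarrow> 'o \<Rightarrow> 'o \<Rightarrow> bool" where
  "le_right T M N \<longleftrightarrow> (\<exists>Z S v u g h. is_biprod T Z M S \<and> v \<in> mor T Z Z \<and> u \<in> mor T M Z \<and>
     dist T N (sum_ob S) Z g (row_mor T S Z v u) h)"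

definition le_nil_right :: "('k, 'o, 'm, 's) tri_cat_scheme \<Rightarrow> 'o \<Rightarrow> 'o \<Rightarrow> bool" where
  "le_nil_right T M N \<longleftrightarrow> (\<exists>Z S v u g h. is_biprod T Z M S \<and> v \<in> mor T Z Z \<and> u \<in> mor T M Z \<and>
     dist T N (sum_ob S) Z g (row_mor T S Z v u) h \<and> nilpotent_endo T Z v)"

(* The square with f : A \<rightarrow> B, g : A \<rightarrow> C, f' : C \<rightarrow> D, g' : B \<rightarrow> D. *)
definition homotopy_cartesian ::
  "('k, 'o, 'm, 's) tri_cat_scheme \<Rightarrow> 'o \<Rightarrow> 'o \<Rightarrow> 'o \<Rightarrow> 'o \<Rightarrow> 'm \<Rightarrow> 'm \<Rightarrow> 'm \<Rightarrow> 'm \<Rightarrow> bool" where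
  "homotopy_cartesian T A B C D f g f' g' \<longleftrightarrow>
     f \<in> mor T A B \<and> g \<in> mor T A C \<and> f' \<in> mor T C D \<and> g' \<in> mor T B D \<and>
     g' \<cdot>\<^bsub>T\<^esub> f = f' \<cdot>\<^bsub>T\<^esub> g \<and>
     (\<exists>S h. is_biprod T C B S \<and>
        dist T A (sum_ob S) D (col_mor T A S g (\<ominus>\<^bsub>Hom T A B\<^esub> f)) (row_mor T S D f' g') h)"

(* A, with f : A \<rightarrow> B and g : A \<rightarrow> C, is a homotopy pullback of B -g'-> D <-f'- C. *)
definition homotopy_pullback ::
  "('k, 'o, 'm, 's) tri_cat_scheme \<Rightarrow> 'o \<Rightarrow> 'o \<Rightarrow> 'o \<Rightarrow> 'm \<Rightarrow> 'm \<Rightarrow> 'o \<Rightarrow> 'm \<Rightarrow> 'm \<Rightarrow> bool" where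
  "homotopy_pullback T B D C g' f' A f g \<longleftrightarrow> homotopy_cartesian T A B C D f g f' g'"

(* D, with f' : C \<rightarrow> D and g' : B \<rightarrow> D, is a homotopy pushout of B <-f- A -g-> C. *)
definition homotopy_pushout ::
  "('k, 'o, 'm, 's) tri_cat_scheme \<Rightarrow> 'o \<Rightarrow> 'o \<Rightarrow> 'o \<Rightarrow> 'm \<Rightarrow> 'm \<Rightarrow> 'o \<Rightarrow> 'm \<Rightarrow> 'm \<Rightarrow> bool" where
  "homotopy_pushout T B A C f g D f' g' \<longleftrightarrow> homotopy_cartesian T A B C D f g f' g'"

end

theory Submission
  imports Defs
begin

text \<open>
  The octahedral axiom identifies \<open>cone(\<pi>)\<close> and \<open>cone(\<sigma>)\<close> with cones of
  the endomorphisms. Write \<open>\<pi>\<close> as the composite of the inclusion \<open>M \<rightarrow> M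
  \<oplus> Z\<close>, whose cone is \<open>Z\<close>, with the row \<open>(\<pi> \<tau>) : M \<oplus> Z
  \<rightarrow> N\<close>, whose cone is \<open>Z[1]\<close> by rotating the given triangle. The octahedral
  axiom puts \<open>cone(\<pi>)\<close> into a triangle \<open>Z \<rightarrow> cone(\<pi>) \<rightarrow> Z[1]
  \<rightarrow> Z[1]\<close> whose last map is the negated shift of the column \<open>(u, v)\<close> followed
  by the projection to \<open>Z[1]\<close>, that is, \<open>-v[1]\<close>. Rotating back,
  \<open>cone(\<pi>)\<close> is a cone of \<open>v\<close> (\<open>cone_of_left_entry\<close>). Dually,
  \<open>\<sigma>\<close> is the column \<open>(\<sigma>, \<lambda>)\<close>, with cone \<open>Z'\<close>,
  followed by the projection \<open>M \<oplus> Z' \<rightarrow> M\<close>, with cone \<open>Z'[1]\<close>, and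
  the same argument makes \<open>cone(\<sigma>)\<close> a cone of \<open>v'\<close>
  (\<open>cone_of_right_entry\<close>). Since cones are unique up to isomorphism (\<open>cone_unique\<close>),
  this gives both isomorphisms.

  A triangle \<open>Z \<rightarrow> Z \<rightarrow> C \<rightarrow> Z[1]\<close> starting with \<open>v\<close> is, up to a zero summand of the middle term, a
  witness of the left comparison of \<open>0\<close> with \<open>C\<close>. Rotated twice it reads
  \<open>C \<rightarrow> Z[1] \<rightarrow> Z[1] \<rightarrow> C[1]\<close> with middle map \<open>-v[1]\<close>, a witness of the right comparison; shift and
  sign preserve nilpotency.

  For the last part, the triangle that defines a homotopy pullback or pushout is itself a witness of the
  comparison, with \<open>u'\<close> replaced by \<open>-u'\<close> in the case of a pushout. Pushouts exist
  because every column has a cone, pullbacks because every row is the second map of a triangle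
  (\<open>cocone_exists\<close>).
\<close>

section \<open>Calculating with typed morphisms\<close>

context klinear_category
begin

abbreviation comp_in (infixr "\<bullet>" 75) where "g \<bullet> f \<equiv> g \<cdot>\<^bsub>T\<^esub> f"

abbreviation zero_mor where "zero_mor X Y \<equiv> \<zero>\<^bsub>Hom T X Y\<^esub>"

abbreviation neg_mor where "neg_mor X Y f \<equiv> \<ominus>\<^bsub>Hom T X Y\<^esub> f"

abbreviation add_mor where "add_mor X Y f g \<equiv> f \<oplus>\<^bsub>Hom T X Y\<^esub> g"

text \<open>The axioms speak about hom-sets between objects only. Including membership of the endpoints in
  the typing judgement makes it closed under composition and addition without side conditions.\<close>

definition arr :: "'o \<Rightarrow> 'o \<Rightarrow> 'm \<Rightarrow> bool" where
  "arr X Y f \<longleftrightarrow> X \<in> Ob T \<and> Y \<in> Ob T \<and> f \<in> mor T X Y"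

lemma arrI: "\<lbrakk>X \<in> Ob T; Y \<in> Ob T; f \<in> mor T X Y\<rbrakk> \<Longrightarrow> arr X Y f"
  by (simp add: arr_def)

lemma arrD:
  assumes "arr X Y f"
  shows "X \<in> Ob T" "Y \<in> Ob T" "f \<in> mor T X Y"
  using assms by (simp_all add: arr_def)

lemma hom_abelian_group: "\<lbrakk>X \<in> Ob T; Y \<in> Ob T\<rbrakk> \<Longrightarrow> abelian_group (Hom T X Y)"
  using hom_module by (simp add: module_def)

lemma arr_ident: "X \<in> Ob T \<Longrightarrow> arr X X (ident T X)"
  by (simp add: arr_def ident_closed)

lemma arr_comp: "\<lbrakk>arr X Y f; arr Y Z g\<rbrakk> \<Longrightarrow> arr X Z (g \<bullet> f)"
  unfolding arr_def using comp_closed by blast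

lemma arr_zero: "\<lbrakk>X \<in> Ob T; Y \<in> Ob T\<rbrakk> \<Longrightarrow> arr X Y (zero_mor X Y)"
  by (simp add: arr_def hom_abelian_group abelian_group.axioms(1) abelian_monoid.zero_closed)

lemma arr_neg: "arr X Y f \<Longrightarrow> arr X Y (neg_mor X Y f)"
  by (simp add: arr_def hom_abelian_group abelian_group.a_inv_closed)

lemma arr_add: "\<lbrakk>arr X Y f; arr X Y g\<rbrakk> \<Longrightarrow> arr X Y (add_mor X Y f g)"
  by (simp add: arr_def hom_abelian_group abelian_group.axioms(1) abelian_monoid.a_closed)

lemma comp_ident:
  assumes "arr X Y f"
  shows "ident T Y \<bullet> f = f" and "f \<bullet> ident T X = f"
  using assms ident_left ident_right by (auto simp: arr_def)

lemma arr_assoc: "\<lbrakk>arr W X f; arr X Y g; arr Y Z h\<rbrakk> \<Longrightarrow> (h \<bullet> g) \<bullet> f = h \<bullet> g \<bullet> f"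
  unfolding arr_def using comp_assoc by blast

lemma add_comp: "\<lbrakk>arr X Y f; arr Y Z g; arr Y Z h\<rbrakk> \<Longrightarrow> add_mor Y Z g h \<bullet> f = add_mor X Z (g \<bullet> f) (h \<bullet> f)"
  unfolding arr_def using comp_add_left by blast

lemma comp_add: "\<lbrakk>arr X Y f; arr X Y g; arr Y Z h\<rbrakk> \<Longrightarrow> h \<bullet> add_mor X Y f g = add_mor X Z (h \<bullet> f) (h \<bullet> g)"
  unfolding arr_def using comp_add_right by blast

lemma add_zero:
  assumes "arr X Y f"
  shows "add_mor X Y f (zero_mor X Y) = f" and "add_mor X Y (zero_mor X Y) f = f"
proof -
  interpret H: abelian_group "Hom T X Y" using assms by (simp add: arr_def hom_abelian_group)
  show "add_mor X Y f (zero_mor X Y) = f" "add_mor X Y (zero_mor X Y) f = f"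
    using assms by (simp_all add: arr_def)
qed

lemma add_neg:
  assumes "arr X Y f"
  shows "add_mor X Y f (neg_mor X Y f) = zero_mor X Y"
    and "add_mor X Y (neg_mor X Y f) f = zero_mor X Y"
proof -
  interpret H: abelian_group "Hom T X Y" using assms by (simp add: arr_def hom_abelian_group)
  show "add_mor X Y f (neg_mor X Y f) = zero_mor X Y"
    "add_mor X Y (neg_mor X Y f) f = zero_mor X Y"
    using assms by (simp_all add: arr_def H.r_neg H.l_neg)
qed

lemma add_commute: "\<lbrakk>arr X Y f; arr X Y g\<rbrakk> \<Longrightarrow> add_mor X Y f g = add_mor X Y g f"
  by (simp add: arr_def hom_abelian_group abelian_group.axioms(1) abelian_monoid.a_comm)

lemma neg_neg: "arr X Y f \<Longrightarrow> neg_mor X Y (neg_mor X Y f) = f"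
  by (simp add: arr_def hom_abelian_group abelian_group.minus_minus)

lemma neg_zero:
  assumes "X \<in> Ob T" "Y \<in> Ob T"
  shows "neg_mor X Y (zero_mor X Y) = zero_mor X Y"
  using add_neg(2)[OF arr_zero[OF assms]] add_zero(1)[OF arr_neg[OF arr_zero[OF assms]]] by simp

lemma neg_eqD:
  assumes "neg_mor X Y f = neg_mor X Y g" "arr X Y f" "arr X Y g"
  shows "f = g"
  using arg_cong[OF assms(1), of "neg_mor X Y"] neg_neg assms(2,3) by simp

lemma zero_if_idem:
  assumes "arr X Y f" "add_mor X Y f f = f"
  shows "f = zero_mor X Y"
proof -
  interpret H: abelian_group "Hom T X Y" using assms by (simp add: arr_def hom_abelian_group)
  show ?thesis using assms by (simp add: arr_def H.add.r_cancel_one')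
qed

lemma neg_unique:
  assumes "arr X Y f" "arr X Y g" "add_mor X Y g f = zero_mor X Y"
  shows "g = neg_mor X Y f"
proof -
  interpret H: abelian_group "Hom T X Y" using assms by (simp add: arr_def hom_abelian_group)
  show ?thesis using assms H.minus_equality by (simp add: arr_def)
qed

lemma comp_zero_right:
  assumes "X \<in> Ob T" "arr Y Z g"
  shows "g \<bullet> zero_mor X Y = zero_mor X Z"
proof -
  have z: "arr X Y (zero_mor X Y)" using assms arr_zero arrD by blast
  show ?thesis
    by (rule zero_if_idem[OF arr_comp[OF z assms(2)]])
      (use comp_add[OF z z assms(2)] add_zero(1)[OF z] in simp)
qed

lemma comp_zero_left:
  assumes "arr X Y f" "Z \<in> Ob T"
  shows "zero_mor Y Z \<bullet> f = zero_mor X Z"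
proof -
  have z: "arr Y Z (zero_mor Y Z)" using assms arr_zero arrD by blast
  show ?thesis
    by (rule zero_if_idem[OF arr_comp[OF assms(1) z]])
      (use add_comp[OF assms(1) z z] add_zero(1)[OF z] in simp)
qed

lemma comp_neg_right:
  assumes f: "arr X Y f" and g: "arr Y Z g"
  shows "g \<bullet> neg_mor X Y f = neg_mor X Z (g \<bullet> f)"
  by (rule neg_unique[OF arr_comp[OF f g] arr_comp[OF arr_neg[OF f] g]])
    (use comp_add[OF arr_neg[OF f] f g] add_neg(2)[OF f] comp_zero_right[OF arrD(1)[OF f] g] in simp)

lemma comp_neg_left:
  assumes f: "arr X Y f" and g: "arr Y Z g"
  shows "neg_mor Y Z g \<bullet> f = neg_mor X Z (g \<bullet> f)"
  by (rule neg_unique[OF arr_comp[OF f g] arr_comp[OF f arr_neg[OF g]]])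
    (use add_comp[OF f arr_neg[OF g] g] add_neg(2)[OF g] comp_zero_left[OF f arrD(2)[OF g]] in simp)

lemma eq_if_diff_zero:
  assumes "arr X Y f" "arr X Y g" "add_mor X Y f (neg_mor X Y g) = zero_mor X Y"
  shows "f = g"
  using neg_unique[OF arr_neg[OF assms(2)] assms(1) assms(3)] neg_neg[OF assms(2)] by simp

lemma is_iso_ident: "X \<in> Ob T \<Longrightarrow> is_iso T X X (ident T X)"
  unfolding is_iso_def using ident_closed ident_left by blast

text \<open>A left and a right inverse coincide, so the two may be constructed independently.\<close>

lemma is_isoI:
  assumes "arr X Y f" "arr Y X g" "arr Y X g'" "g \<bullet> f = ident T X" "f \<bullet> g' = ident T Y"
  shows "is_iso T X Y f"
proof -
  have "g = g \<bullet> f \<bullet> g'" using assms comp_ident by simp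
  also have "\<dots> = g'" using arr_assoc[OF assms(3,1,2)] assms(4) comp_ident(1)[OF assms(3)] by simp
  finally show ?thesis using assms unfolding is_iso_def arr_def by blast
qed

lemma isomorphicE:
  assumes "isomorphic T X Y"
  obtains f g where "arr X Y f" "arr Y X g" "g \<bullet> f = ident T X" "f \<bullet> g = ident T Y"
    "is_iso T X Y f" "is_iso T Y X g"
  using assms unfolding isomorphic_def is_iso_def arr_def by blast

lemma zero_object_Ob: "zero_object T O0 \<Longrightarrow> O0 \<in> Ob T"
  by (simp add: zero_object_def)

lemma zero_object_into:
  assumes "zero_object T O0" "arr X O0 f"
  shows "f = zero_mor X O0"
  using assms arr_zero[of X O0] unfolding zero_object_def arr_def by blast

lemma zero_object_from:
  assumes "zero_object T O0" "arr O0 X f"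
  shows "f = zero_mor O0 X"
  using assms arr_zero[of O0 X] unfolding zero_object_def arr_def by blast

lemma zero_objectI:
  assumes X: "X \<in> Ob T" and "ident T X = zero_mor X X"
  shows "zero_object T X"
proof -
  have from_X: "\<exists>!f. f \<in> mor T X Y" if Y: "Y \<in> Ob T" for Y
  proof (rule ex1I)
    show "zero_mor X Y \<in> mor T X Y" by (rule arrD(3)[OF arr_zero[OF X Y]])
    show "f = zero_mor X Y" if "f \<in> mor T X Y" for f
      using comp_ident(2)[OF arrI[OF X Y that]] comp_zero_right[OF X arrI[OF X Y that]] assms(2)
      by simp
  qed
  have to_X: "\<exists>!f. f \<in> mor T Y X" if Y: "Y \<in> Ob T" for Y
  proof (rule ex1I)
    show "zero_mor Y X \<in> mor T Y X" by (rule arrD(3)[OF arr_zero[OF Y X]])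
    show "f = zero_mor Y X" if "f \<in> mor T Y X" for f
      using comp_ident(1)[OF arrI[OF Y X that]] comp_zero_left[OF arrI[OF Y X that] X] assms(2)
      by simp
  qed
  show ?thesis unfolding zero_object_def by (intro conjI ballI X from_X to_X)
qed

lemma biprod_arr:
  assumes "is_biprod T A B S"
  shows "arr A (sum_ob S) (in1 S)" "arr B (sum_ob S) (in2 S)"
    "arr (sum_ob S) A (pr1 S)" "arr (sum_ob S) B (pr2 S)"
  using assms by (simp_all add: is_biprod_def arr_def)

lemma biprod_simps:
  assumes "is_biprod T A B S"
  shows "pr1 S \<bullet> in1 S = ident T A" "pr2 S \<bullet> in2 S = ident T B"
    "pr1 S \<bullet> in2 S = zero_mor B A" "pr2 S \<bullet> in1 S = zero_mor A B"
    "add_mor (sum_ob S) (sum_ob S) (in1 S \<bullet> pr1 S) (in2 S \<bullet> pr2 S) = ident T (sum_ob S)"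
  using assms by (simp_all add: is_biprod_def)

lemma biprod_swap:
  assumes "is_biprod T A B S"
  shows "is_biprod T B A \<lparr>sum_ob = sum_ob S, in1 = in2 S, in2 = in1 S, pr1 = pr2 S, pr2 = pr1 S\<rparr>"
  using assms add_commute[OF arr_comp[OF biprod_arr(3) biprod_arr(1)] arr_comp[OF biprod_arr(4) biprod_arr(2)], OF assms assms assms assms]
  by (simp add: is_biprod_def)

lemma arr_col:
  assumes "is_biprod T A B S" "arr X A a" "arr X B b"
  shows "arr X (sum_ob S) (col_mor T X S a b)"
  unfolding col_mor_def
  by (rule arr_add[OF arr_comp[OF assms(2) biprod_arr(1)[OF assms(1)]]
        arr_comp[OF assms(3) biprod_arr(2)[OF assms(1)]]])

lemma arr_row:
  assumes "is_biprod T A B S" "arr A Y a" "arr B Y b"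
  shows "arr (sum_ob S) Y (row_mor T S Y a b)"
  unfolding row_mor_def
  by (rule arr_add[OF arr_comp[OF biprod_arr(3)[OF assms(1)] assms(2)]
        arr_comp[OF biprod_arr(4)[OF assms(1)] assms(3)]])

lemma pr_col:
  assumes S: "is_biprod T A B S" and a: "arr X A a" and b: "arr X B b"
  shows "pr1 S \<bullet> col_mor T X S a b = a" "pr2 S \<bullet> col_mor T X S a b = b"
proof -
  note B = biprod_arr[OF S] biprod_simps[OF S]
  have ia: "arr X (sum_ob S) (in1 S \<bullet> a)" and ib: "arr X (sum_ob S) (in2 S \<bullet> b)"
    using B a b arr_comp by blast+
  have "pr1 S \<bullet> col_mor T X S a b = add_mor X A (pr1 S \<bullet> in1 S \<bullet> a) (pr1 S \<bullet> in2 S \<bullet> b)"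
    unfolding col_mor_def by (rule comp_add[OF ia ib B(3)])
  also have "\<dots> = add_mor X A a (zero_mor X A)"
    using arr_assoc[OF a B(1) B(3)] arr_assoc[OF b B(2) B(3)] B a b
    by (simp add: comp_ident[OF a] comp_zero_left[OF b arrD(2)[OF a]])
  finally show "pr1 S \<bullet> col_mor T X S a b = a" using add_zero[OF a] by simp
  have "pr2 S \<bullet> col_mor T X S a b = add_mor X B (pr2 S \<bullet> in1 S \<bullet> a) (pr2 S \<bullet> in2 S \<bullet> b)"
    unfolding col_mor_def by (rule comp_add[OF ia ib B(4)])
  also have "\<dots> = add_mor X B (zero_mor X B) b"
    using arr_assoc[OF a B(1) B(4)] arr_assoc[OF b B(2) B(4)] B a b
    by (simp add: comp_ident[OF b] comp_zero_left[OF a arrD(2)[OF b]])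
  finally show "pr2 S \<bullet> col_mor T X S a b = b" using add_zero[OF b] by simp
qed

lemma row_in:
  assumes S: "is_biprod T A B S" and a: "arr A Y a" and b: "arr B Y b"
  shows "row_mor T S Y a b \<bullet> in1 S = a" "row_mor T S Y a b \<bullet> in2 S = b"
proof -
  note B = biprod_arr[OF S] biprod_simps[OF S]
  have ia: "arr (sum_ob S) Y (a \<bullet> pr1 S)" and ib: "arr (sum_ob S) Y (b \<bullet> pr2 S)"
    using B a b arr_comp by blast+
  have "row_mor T S Y a b \<bullet> in1 S = add_mor A Y ((a \<bullet> pr1 S) \<bullet> in1 S) ((b \<bullet> pr2 S) \<bullet> in1 S)"
    unfolding row_mor_def by (rule add_comp[OF B(1) ia ib])
  also have "\<dots> = add_mor A Y a (zero_mor A Y)"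
    using arr_assoc[OF B(1) B(3) a] arr_assoc[OF B(1) B(4) b] B a b
    by (simp add: comp_ident[OF a] comp_zero_right[OF arrD(1)[OF a] b])
  finally show "row_mor T S Y a b \<bullet> in1 S = a" using add_zero[OF a] by simp
  have "row_mor T S Y a b \<bullet> in2 S = add_mor B Y ((a \<bullet> pr1 S) \<bullet> in2 S) ((b \<bullet> pr2 S) \<bullet> in2 S)"
    unfolding row_mor_def by (rule add_comp[OF B(2) ia ib])
  also have "\<dots> = add_mor B Y (zero_mor B Y) b"
    using arr_assoc[OF B(2) B(3) a] arr_assoc[OF B(2) B(4) b] B a b
    by (simp add: comp_ident[OF b] comp_zero_right[OF arrD(1)[OF b] a])
  finally show "row_mor T S Y a b \<bullet> in2 S = b" using add_zero[OF b] by simp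
qed

lemma col_eta:
  assumes S: "is_biprod T A B S" and f: "arr X (sum_ob S) f"
  shows "col_mor T X S (pr1 S \<bullet> f) (pr2 S \<bullet> f) = f"
proof -
  note B = biprod_arr[OF S] biprod_simps[OF S]
  have "col_mor T X S (pr1 S \<bullet> f) (pr2 S \<bullet> f)
      = add_mor X (sum_ob S) ((in1 S \<bullet> pr1 S) \<bullet> f) ((in2 S \<bullet> pr2 S) \<bullet> f)"
    unfolding col_mor_def using arr_assoc[OF f B(3) B(1)] arr_assoc[OF f B(4) B(2)] by simp
  also have "\<dots> = ident T (sum_ob S) \<bullet> f"
    using add_comp[OF f arr_comp[OF B(3) B(1)] arr_comp[OF B(4) B(2)]] B by simp
  finally show ?thesis using comp_ident[OF f] by simp
qed

lemma row_eta:
  assumes S: "is_biprod T A B S" and f: "arr (sum_ob S) Y f"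
  shows "row_mor T S Y (f \<bullet> in1 S) (f \<bullet> in2 S) = f"
proof -
  note B = biprod_arr[OF S] biprod_simps[OF S]
  have "row_mor T S Y (f \<bullet> in1 S) (f \<bullet> in2 S)
      = add_mor (sum_ob S) Y (f \<bullet> in1 S \<bullet> pr1 S) (f \<bullet> in2 S \<bullet> pr2 S)"
    unfolding row_mor_def using arr_assoc[OF B(3) B(1) f] arr_assoc[OF B(4) B(2) f] by simp
  also have "\<dots> = f \<bullet> ident T (sum_ob S)"
    using comp_add[OF arr_comp[OF B(3) B(1)] arr_comp[OF B(4) B(2)] f] B by simp
  finally show ?thesis using comp_ident[OF f] by simp
qed

lemma row_col:
  assumes S: "is_biprod T A B S" and "arr X A a" "arr X B b" "arr A Y c" "arr B Y d"
  shows "row_mor T S Y c d \<bullet> col_mor T X S a b = add_mor X Y (c \<bullet> a) (d \<bullet> b)"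
proof -
  note B = biprod_arr[OF S]
  have K: "arr X (sum_ob S) (col_mor T X S a b)" by (rule arr_col[OF assms(1-3)])
  have "row_mor T S Y c d \<bullet> col_mor T X S a b
      = add_mor X Y ((c \<bullet> pr1 S) \<bullet> col_mor T X S a b) ((d \<bullet> pr2 S) \<bullet> col_mor T X S a b)"
    unfolding row_mor_def
    by (rule add_comp[OF K arr_comp[OF B(3) assms(4)] arr_comp[OF B(4) assms(5)]])
  then show ?thesis
    using arr_assoc[OF K B(3) assms(4)] arr_assoc[OF K B(4) assms(5)] pr_col[OF assms(1-3)] by simp
qed

text \<open>Adding a zero object does not change an object; this is what lets a cone of an endomorphism
  be read as a triangle witnessing a comparison with the zero object.\<close>

lemma biprod_zero_iso:
  assumes S: "is_biprod T Z O0 S" and z: "zero_object T O0"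
  shows "is_iso T Z (sum_ob S) (in1 S)" "in1 S \<bullet> pr1 S = ident T (sum_ob S)"
proof -
  note B = biprod_arr[OF S] biprod_simps[OF S]
  have "in2 S \<bullet> pr2 S = zero_mor (sum_ob S) (sum_ob S)"
    using zero_object_into[OF z B(4)] comp_zero_right[OF arrD(1)[OF B(4)] B(2)] by simp
  then show e: "in1 S \<bullet> pr1 S = ident T (sum_ob S)"
    using B(9) add_zero(1)[OF arr_comp[OF B(3) B(1)]] by simp
  show "is_iso T Z (sum_ob S) (in1 S)" by (rule is_isoI[OF B(1) B(3) B(3) B(5) e])
qed

lemma arr_endo_pow: "arr Z Z v \<Longrightarrow> arr Z Z (endo_pow T Z v n)"
  by (induction n) (auto intro: arr_ident arr_comp arrD)

text \<open>A disjunction suffices for nilpotency, and it spares tracking the parity of the exponent.\<close>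

lemma endo_pow_neg:
  assumes "arr Z Z v"
  shows "endo_pow T Z (neg_mor Z Z v) n = endo_pow T Z v n
    \<or> endo_pow T Z (neg_mor Z Z v) n = neg_mor Z Z (endo_pow T Z v n)"
proof (induction n)
  case 0 show ?case by simp
next
  case (Suc n)
  have p: "arr Z Z (endo_pow T Z v n)" by (rule arr_endo_pow[OF assms])
  show ?case
    using Suc comp_neg_left[OF p assms] comp_neg_left[OF arr_neg[OF p] assms]
      comp_neg_right[OF p assms] neg_neg[OF arr_comp[OF p assms]] by auto
qed

lemma nilpotent_neg:
  assumes "nilpotent_endo T Z v" "Z \<in> Ob T"
  shows "nilpotent_endo T Z (neg_mor Z Z v)"
proof -
  have v: "arr Z Z v" using assms by (simp add: nilpotent_endo_def arr_def)
  obtain n where "endo_pow T Z v n = zero_mor Z Z" using assms by (auto simp: nilpotent_endo_def)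
  then have "endo_pow T Z (neg_mor Z Z v) n = zero_mor Z Z"
    using endo_pow_neg[OF v, of n] neg_zero[OF assms(2) assms(2)] by auto
  then show ?thesis using arr_neg[OF v] by (auto simp: nilpotent_endo_def arr_def)
qed

end

section \<open>Elementary consequences of Verdier's axioms\<close>

context triangulated_kcategory
begin

lemma arr_shm: "arr X Y f \<Longrightarrow> arr (sh T X) (sh T Y) (shm T f)"
  using sh_full_faithful sh_closed unfolding arr_def bij_betw_def by blast

lemma shm_full:
  assumes "X \<in> Ob T" "Y \<in> Ob T" "arr (sh T X) (sh T Y) f"
  obtains g where "arr X Y g" "shm T g = f"
proof -
  have "f \<in> shm T ` mor T X Y"
    using bij_betw_imp_surj_on[OF sh_full_faithful[OF assms(1,2)]] arrD(3)[OF assms(3)] by simp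
  then show ?thesis using that arrI[OF assms(1,2)] by auto
qed

lemma shm_faithful:
  assumes "arr X Y f" "arr X Y g" "shm T f = shm T g"
  shows "f = g"
  using bij_betw_imp_inj_on[OF sh_full_faithful[OF arrD(1,2)[OF assms(1)]]] assms(3)
    arrD(3)[OF assms(1)] arrD(3)[OF assms(2)] by (rule inj_onD)

lemma shm_comp_arr: "\<lbrakk>arr X Y f; arr Y Z g\<rbrakk> \<Longrightarrow> shm T (g \<bullet> f) = shm T g \<bullet> shm T f"
  unfolding arr_def using shm_comp by blast

lemma shm_zero:
  assumes "X \<in> Ob T" "Y \<in> Ob T"
  shows "shm T (zero_mor X Y) = zero_mor (sh T X) (sh T Y)"
proof (rule zero_if_idem)
  show "arr (sh T X) (sh T Y) (shm T (zero_mor X Y))" using assms arr_shm arr_zero by blast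
  show "add_mor (sh T X) (sh T Y) (shm T (zero_mor X Y)) (shm T (zero_mor X Y)) = shm T (zero_mor X Y)"
    using shm_add[OF assms, of "zero_mor X Y" "zero_mor X Y"] arr_zero[OF assms]
      add_zero(1)[OF arr_zero[OF assms]] by (simp add: arr_def)
qed

lemma shm_neg:
  assumes "arr X Y f"
  shows "shm T (neg_mor X Y f) = neg_mor (sh T X) (sh T Y) (shm T f)"
proof (rule neg_unique)
  show "arr (sh T X) (sh T Y) (shm T f)" "arr (sh T X) (sh T Y) (shm T (neg_mor X Y f))"
    using assms arr_shm arr_neg by blast+
  show "add_mor (sh T X) (sh T Y) (shm T (neg_mor X Y f)) (shm T f) = zero_mor (sh T X) (sh T Y)"
    using shm_add[of X Y "neg_mor X Y f" f] assms arr_neg[OF assms] add_neg(2)[OF assms] shm_zero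
    by (simp add: arr_def)
qed

lemma shm_endo_pow:
  assumes "arr Z Z v"
  shows "endo_pow T (sh T Z) (shm T v) n = shm T (endo_pow T Z v n)"
proof (induction n)
  case 0
  then show ?case using assms by (simp add: shm_ident arr_def)
next
  case (Suc n)
  then show ?case using shm_comp_arr[OF arr_endo_pow[OF assms, of n] assms] by simp
qed

lemma nilpotent_shm:
  assumes "nilpotent_endo T Z v" "Z \<in> Ob T"
  shows "nilpotent_endo T (sh T Z) (shm T v)"
proof -
  have v: "arr Z Z v" using assms by (simp add: nilpotent_endo_def arr_def)
  obtain n where "endo_pow T Z v n = zero_mor Z Z" using assms by (auto simp: nilpotent_endo_def)
  then have "endo_pow T (sh T Z) (shm T v) n = zero_mor (sh T Z) (sh T Z)"
    using shm_endo_pow[OF v] shm_zero[OF assms(2) assms(2)] by simp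
  then show ?thesis using arr_shm[OF v] by (auto simp: nilpotent_endo_def arr_def)
qed

lemma zero_object_sh:
  assumes "zero_object T O0"
  shows "zero_object T (sh T O0)"
proof (rule zero_objectI)
  have o: "O0 \<in> Ob T" by (rule zero_object_Ob[OF assms])
  then show "sh T O0 \<in> Ob T" by (rule sh_closed)
  show "ident T (sh T O0) = zero_mor (sh T O0) (sh T O0)"
    using zero_object_from[OF assms arr_ident[OF o]] shm_ident[OF o] shm_zero[OF o o] by simp
qed

lemma dist_arr:
  assumes "dist T X Y Z f g h"
  shows "arr X Y f" "arr Y Z g" "arr Z (sh T X) h"
  using dist_typed[OF assms] sh_closed by (auto simp: arr_def)

lemma dist_rotate:
  "dist T X Y Z f g h \<Longrightarrow> dist T Y Z (sh T X) g h (neg_mor (sh T X) (sh T Y) (shm T f))"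
  using TR2 dist_typed by blast

lemma dist_unrotate:
  assumes "dist T Y Z (sh T X) g h (neg_mor (sh T X) (sh T Y) (shm T f))" "arr X Y f"
  shows "dist T X Y Z f g h"
  using TR2[of X Y Z f g h] dist_arr[OF assms(1)] assms by (simp add: arr_def)

lemma dist_fill:
  assumes d: "dist T X Y Z f g h" and d': "dist T X' Y' Z' f' g' h'"
    and "arr X X' a" "arr Y Y' b" "b \<bullet> f = f' \<bullet> a"
  shows "\<exists>c. arr Z Z' c \<and> c \<bullet> g = g' \<bullet> b \<and> shm T a \<bullet> h = h' \<bullet> c"
  using TR3[OF d d'] dist_typed[OF d] dist_typed[OF d'] assms(3-5) unfolding arr_def by blast

text \<open>Map the trivial triangle on \<open>X\<close> to the given one: its third object is zero, so the completing
  morphism forces \<open>g \<bullet> f\<close> to factor through zero.\<close>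

lemma dist_comp_zero:
  assumes d: "dist T X Y Z f g h"
  shows "g \<bullet> f = zero_mor X Z" "h \<bullet> g = zero_mor Y (sh T X)"
proof -
  have *: "g \<bullet> f = zero_mor X Z" if d: "dist T X Y Z f g h" for X Y Z f g h
  proof -
    obtain O0 where z: "zero_object T O0" using zero_object_exists by blast
    note A = dist_arr[OF d]
    have X: "X \<in> Ob T" by (rule arrD(1)[OF A(1)])
    obtain c where c: "arr O0 Z c" "c \<bullet> zero_mor X O0 = g \<bullet> f"
      using dist_fill[OF TR1_ident[OF X z] d arr_ident[OF X] A(1)] by blast
    then show ?thesis using comp_zero_right[OF X c(1)] by simp
  qed
  show "g \<bullet> f = zero_mor X Z" by (rule *[OF d])
  show "h \<bullet> g = zero_mor Y (sh T X)" by (rule *[OF dist_rotate[OF d]])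
qed

text \<open>A morphism that kills \<open>f\<close> is a morphism of pairs from \<open>f\<close> to \<open>0 \<rightarrow> W\<close>, and the cone of the
  latter is \<open>W\<close> itself.\<close>

lemma dist_weak_cokernel:
  assumes d: "dist T X Y Z f g h" and x: "arr Y W x" "x \<bullet> f = zero_mor X W"
  shows "\<exists>y. arr Z W y \<and> y \<bullet> g = x"
proof -
  obtain O0 where z: "zero_object T O0" using zero_object_exists by blast
  have o: "O0 \<in> Ob T" and W: "W \<in> Ob T" and X: "X \<in> Ob T"
    using zero_object_Ob[OF z] x dist_typed[OF d] by (auto simp: arr_def)
  \<comment> \<open>This is the rotation of the trivial triangle on \<open>W\<close> ending in the zero object \<open>O0[1]\<close>.\<close>
  have e: "dist T O0 W W (zero_mor O0 W) (ident T W) (zero_mor W (sh T O0))"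
  proof (rule dist_unrotate[OF _ arr_zero[OF o W]])
    show "dist T W W (sh T O0) (ident T W) (zero_mor W (sh T O0))
        (neg_mor (sh T O0) (sh T W) (shm T (zero_mor O0 W)))"
      using TR1_ident[OF W zero_object_sh[OF z]] shm_zero[OF o W] neg_zero sh_closed o W by simp
  qed
  have "x \<bullet> f = zero_mor O0 W \<bullet> zero_mor X O0"
    using x comp_zero_right[OF X arr_zero[OF o W]] by simp
  then obtain c where "arr Z W c" "c \<bullet> g = ident T W \<bullet> x"
    using dist_fill[OF d e arr_zero[OF X o] x(1)] by blast
  then show ?thesis using comp_ident[OF x(1)] by auto
qed

text \<open>Comparing rotations of the given triangle with rotations of the trivial triangles on \<open>Y\<close> and
  \<open>X\<close> produces a right and a left inverse of \<open>f[1]\<close>. They descend to inverses of \<open>f\<close> because the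
  shift is fully faithful.\<close>

lemma iso_if_zero_cone:
  assumes z: "zero_object T O0" and d: "dist T X Y O0 f s h"
  shows "is_iso T X Y f"
proof -
  note A = dist_arr[OF d]
  have X: "X \<in> Ob T" and Y: "Y \<in> Ob T" and o: "O0 \<in> Ob T" using dist_typed[OF d] by auto
  note O = X Y o sh_closed[OF X] sh_closed[OF Y] sh_closed[OF o]
  \<comment> \<open>The identity of \<open>W\<close> turns into \<open>i W\<close> when a trivial triangle is rotated.\<close>
  define i where "i W = neg_mor (sh T W) (sh T W) (shm T (ident T W))" for W
  have i: "i W = neg_mor (sh T W) (sh T W) (ident T (sh T W))" if "W \<in> Ob T" for W
    unfolding i_def by (simp add: shm_ident that)
  have ai: "arr (sh T W) (sh T W) (i W)" if "W \<in> Ob T" for W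
    using i that arr_neg arr_ident sh_closed by simp
  have f1: "arr (sh T X) (sh T Y) (shm T f)" by (rule arr_shm[OF A(1)])
  let ?mf = "neg_mor (sh T X) (sh T Y) (shm T f)"
  have dX: "dist T X X O0 (ident T X) (zero_mor X O0) (zero_mor O0 (sh T X))"
    and dY: "dist T Y Y O0 (ident T Y) (zero_mor Y O0) (zero_mor O0 (sh T Y))"
    using TR1_ident z O by blast+
  \<comment> \<open>A right inverse comes from the morphism of triangles that is the identity on \<open>Y\<close> and \<open>O0\<close>.\<close>
  have "ident T O0 \<bullet> zero_mor Y O0 = s \<bullet> ident T Y"
    using comp_ident[OF arr_zero[OF Y o]] comp_ident[OF A(2)] zero_object_into[OF z A(2)] by simp
  then obtain c where ac: "arr (sh T Y) (sh T X) c" and c: "shm T (ident T Y) \<bullet> i Y = ?mf \<bullet> c"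
    unfolding i_def
    using dist_fill[OF dist_rotate[OF dY] dist_rotate[OF d] arr_ident[OF Y] arr_ident[OF o]] by blast
  have "neg_mor (sh T Y) (sh T Y) (ident T (sh T Y)) = neg_mor (sh T Y) (sh T Y) (shm T f \<bullet> c)"
    using c i[OF Y] comp_ident(1)[OF ai[OF Y]] comp_neg_left[OF ac f1] shm_ident[OF Y] by simp
  then have rc: "shm T f \<bullet> c = ident T (sh T Y)"
    using neg_eqD[OF _ arr_ident[OF O(5)] arr_comp[OF ac f1]] by simp
  obtain p where p: "arr Y X p" "shm T p = c" using shm_full[OF Y X ac] by blast
  have fp: "f \<bullet> p = ident T Y"
    using shm_faithful[OF arr_comp[OF p(1) A(1)] arr_ident[OF Y]] shm_comp_arr[OF p(1) A(1)] p(2) rc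
      shm_ident[OF Y] by simp
  \<comment> \<open>A left inverse comes from the one that is the identity on \<open>O0\<close> and \<open>X[1]\<close>.\<close>
  have "ident T (sh T X) \<bullet> h = zero_mor O0 (sh T X) \<bullet> ident T O0"
    using zero_object_from[OF z A(3)] comp_ident[OF arr_zero[OF o O(4)]] by simp
  then obtain e where ae: "arr (sh T Y) (sh T X) e" and e: "e \<bullet> ?mf = i X \<bullet> ident T (sh T X)"
    unfolding i_def
    using dist_fill[OF dist_rotate[OF dist_rotate[OF d]] dist_rotate[OF dist_rotate[OF dX]]
        arr_ident[OF o] arr_ident[OF O(4)]] by blast
  have "neg_mor (sh T X) (sh T X) (e \<bullet> shm T f) = neg_mor (sh T X) (sh T X) (ident T (sh T X))"
    using e i[OF X] comp_ident(2)[OF ai[OF X]] comp_neg_right[OF f1 ae] by simp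
  then have lc: "e \<bullet> shm T f = ident T (sh T X)"
    by (rule neg_eqD[OF _ arr_comp[OF f1 ae] arr_ident[OF O(4)]])
  obtain q where q: "arr Y X q" "shm T q = e" using shm_full[OF Y X ae] by blast
  have qf: "q \<bullet> f = ident T X"
    using shm_faithful[OF arr_comp[OF A(1) q(1)] arr_ident[OF X]] shm_comp_arr[OF A(1) q(1)] q(2) lc
      shm_ident[OF X] by simp
  show ?thesis by (rule is_isoI[OF A(1) q(1) p(1) qf fp])
qed

text \<open>The octahedral axiom for the composite of \<open>f\<close> with the identity of \<open>Y\<close>, which has cone zero,
  links the two cones by a triangle with third object zero.\<close>

lemma cone_unique:
  assumes "is_cone T X Y f C" "is_cone T X Y f C'"
  shows "isomorphic T C C'"
proof -
  obtain g h where d: "dist T X Y C f g h" using assms by (auto simp: is_cone_def)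
  obtain g' h' where d': "dist T X Y C' f g' h'" using assms by (auto simp: is_cone_def)
  obtain O0 where z: "zero_object T O0" using zero_object_exists by blast
  have "ident T Y \<bullet> f = f" using comp_ident[OF dist_arr(1)[OF d]] by simp
  then have "dist T X Y C' (ident T Y \<bullet> f) g' h'" using d' by simp
  then obtain r s t where "dist T C C' O0 r s t"
    using TR4[OF d TR1_ident[OF arrD(2)[OF dist_arr(1)[OF d]] z]] by blast
  then show ?thesis using iso_if_zero_cone[OF z] unfolding isomorphic_def by blast
qed

text \<open>Compare \<open>B\<close> with a cone \<open>W\<close> of the inclusion. The connecting morphism of that cone is zero, so
  \<open>g\<close> can be cancelled on the right, and \<open>B\<close> and \<open>W\<close> are both cokernels of the inclusion.\<close>

lemma split_dist:
  assumes S: "is_biprod T A B S"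
  shows "dist T A (sum_ob S) B (in1 S) (pr2 S) (zero_mor B (sh T A))"
proof -
  note B = biprod_arr[OF S] biprod_simps[OF S]
  have A: "A \<in> Ob T" "B \<in> Ob T" using S by (simp_all add: is_biprod_def)
  obtain W g h where d: "dist T A (sum_ob S) W (in1 S) g h"
    using TR1_cone[of A "sum_ob S" "in1 S"] B(1) by (auto simp: arr_def)
  note D = dist_arr[OF d]
  have W: "W \<in> Ob T" by (rule arrD(2)[OF D(2)])
  have SA: "sh T A \<in> Ob T" by (rule sh_closed[OF A(1)])
  \<comment> \<open>The split monomorphism \<open>in1[1]\<close> kills the connecting morphism \<open>h\<close>, which is therefore zero.\<close>
  have i1: "arr (sh T A) (sh T (sum_ob S)) (shm T (in1 S))" by (rule arr_shm[OF B(1)])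
  have p1: "arr (sh T (sum_ob S)) (sh T A) (shm T (pr1 S))" by (rule arr_shm[OF B(3)])
  have "neg_mor W (sh T (sum_ob S)) (shm T (in1 S) \<bullet> h) = zero_mor W (sh T (sum_ob S))"
    using dist_comp_zero(2)[OF dist_rotate[OF d]] comp_neg_left[OF D(3) i1] by simp
  then have "shm T (in1 S) \<bullet> h = zero_mor W (sh T (sum_ob S))"
    using neg_neg[OF arr_comp[OF D(3) i1]] neg_zero[OF W arrD(2)[OF i1]] by simp
  moreover have "shm T (pr1 S) \<bullet> shm T (in1 S) \<bullet> h = h"
    using arr_assoc[OF D(3) i1 p1] shm_comp_arr[OF B(1) B(3)] B(5) shm_ident[OF A(1)] comp_ident[OF D(3)]
    by simp
  ultimately have h: "h = zero_mor W (sh T A)" using comp_zero_right[OF W p1] by simp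
  obtain q where q: "arr W B q" "q \<bullet> g = pr2 S"
    using dist_weak_cokernel[OF d B(4) B(8)] by blast
  define p where "p = g \<bullet> in2 S"
  have p: "arr B W p" unfolding p_def by (rule arr_comp[OF B(2) D(2)])
  have qp: "q \<bullet> p = ident T B" unfolding p_def using arr_assoc[OF B(2) D(2) q(1)] q(2) B(6) by simp
  have g: "g = p \<bullet> q \<bullet> g"
  proof -
    have "g = row_mor T S W (g \<bullet> in1 S) (g \<bullet> in2 S)" using row_eta[OF S D(2)] by simp
    also have "\<dots> = p \<bullet> pr2 S" unfolding row_mor_def
      using dist_comp_zero(1)[OF d] comp_zero_left[OF B(3) W] add_zero(2)[OF arr_comp[OF B(4) p]]
      by (simp add: p_def)
    finally show ?thesis using q by simp
  qed
  have pq: "arr W W (p \<bullet> q)" by (rule arr_comp[OF q(1) p])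
  let ?x = "add_mor W W (p \<bullet> q) (neg_mor W W (ident T W))"
  have mi: "arr W W (neg_mor W W (ident T W))" by (rule arr_neg[OF arr_ident[OF W]])
  have x: "arr W W ?x" by (rule arr_add[OF pq mi])
  \<comment> \<open>The difference \<open>p \<bullet> q - 1\<close> kills \<open>g\<close>, so it factors through \<open>h = 0\<close>.\<close>
  have "?x \<bullet> g = zero_mor (sum_ob S) W"
    using add_comp[OF D(2) pq mi] arr_assoc[OF D(2) q(1) p] g comp_neg_left[OF D(2) arr_ident[OF W]]
      comp_ident[OF D(2)] add_neg(1)[OF D(2)] by simp
  then obtain y where y: "arr (sh T A) W y" "y \<bullet> h = ?x"
    using dist_weak_cokernel[OF dist_rotate[OF d] x] by blast
  then have "?x = zero_mor W W" using h comp_zero_right[OF W y(1)] by simp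
  then have "p \<bullet> q = ident T W" using eq_if_diff_zero[OF pq arr_ident[OF W]] by simp
  then have iso: "is_iso T W B q" using is_isoI[OF q(1) p p] qp by blast
  show ?thesis
  proof (rule TR1_iso[OF d is_iso_ident[OF A(1)] is_iso_ident[OF arrD(2)[OF B(1)]] iso])
    show "in1 S \<in> mor T A (sum_ob S)" "pr2 S \<in> mor T (sum_ob S) B" using B by (auto simp: arr_def)
    show "zero_mor B (sh T A) \<in> mor T B (sh T A)" using arr_zero[OF A(2) SA] by (simp add: arr_def)
    show "ident T (sum_ob S) \<bullet> in1 S = in1 S \<bullet> ident T A" using comp_ident[OF B(1)] by simp
    show "q \<bullet> g = pr2 S \<bullet> ident T (sum_ob S)" using comp_ident[OF B(4)] q by simp
    show "shm T (ident T A) \<bullet> h = zero_mor B (sh T A) \<bullet> q"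
      using h shm_ident[OF A(1)] comp_ident[OF arr_zero[OF W SA]] comp_zero_left[OF q(1) SA] by simp
  qed
qed

text \<open>The third object of a triangle on \<open>f\<close> is a shift only up to isomorphism, and its last map is the
  negated shift of a morphism because the shift is full; so the triangle can be rotated back.\<close>

lemma cocone_exists:
  assumes f: "arr Y Z f"
  obtains X e h where "dist T X Y Z e f h"
proof -
  have O: "Y \<in> Ob T" "Z \<in> Ob T" using f by (auto simp: arr_def)
  obtain C g h where d: "dist T Y Z C f g h" using TR1_cone[of Y Z f] f by (auto simp: arr_def)
  note D = dist_arr[OF d]
  obtain X where X: "X \<in> Ob T" "isomorphic T (sh T X) C"
    using sh_ess_surj dist_typed[OF d] by blast
  obtain i j where ij: "arr (sh T X) C i" "arr C (sh T X) j" "j \<bullet> i = ident T (sh T X)"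
    "i \<bullet> j = ident T C" "is_iso T C (sh T X) j"
    using isomorphicE[OF X(2)] by metis
  have hi: "arr (sh T X) (sh T Y) (h \<bullet> i)" by (rule arr_comp[OF ij(1) D(3)])
  obtain e0 where e0: "arr X Y e0" "shm T e0 = h \<bullet> i" using shm_full[OF X(1) O(1) hi] by blast
  define e where "e = neg_mor X Y e0"
  have e: "arr X Y e" unfolding e_def by (rule arr_neg[OF e0(1)])
  have se: "neg_mor (sh T X) (sh T Y) (shm T e) = h \<bullet> i"
    unfolding e_def using shm_neg[OF e0(1)] e0(2) neg_neg[OF hi] by simp
  have "dist T Y Z (sh T X) f (j \<bullet> g) (h \<bullet> i)"
  proof (rule TR1_iso[OF d is_iso_ident[OF O(1)] is_iso_ident[OF O(2)] ij(5)])
    show "f \<in> mor T Y Z" "h \<bullet> i \<in> mor T (sh T X) (sh T Y)" "j \<bullet> g \<in> mor T Z (sh T X)"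
      using f hi arr_comp[OF D(2) ij(2)] by (auto simp: arr_def)
    show "ident T Z \<bullet> f = f \<bullet> ident T Y" using comp_ident[OF f] by simp
    show "j \<bullet> g = (j \<bullet> g) \<bullet> ident T Z" using comp_ident[OF arr_comp[OF D(2) ij(2)]] by simp
    show "shm T (ident T Y) \<bullet> h = (h \<bullet> i) \<bullet> j"
      using arr_assoc[OF ij(2) ij(1) D(3)] ij(4) comp_ident[OF D(3)] shm_ident[OF O(1)] by simp
  qed
  then show ?thesis using that dist_unrotate[OF _ e] se by metis
qed

section \<open>Cones of endomorphisms and the zero object\<close>

lemma le_left_zero_if_cone:
  assumes z: "zero_object T O0" and v: "arr Z Z v" and c: "is_cone T Z Z v C"
  shows "le_left T O0 C" "nilpotent_endo T Z v \<Longrightarrow> le_nil_left T O0 C"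
proof -
  have o: "O0 \<in> Ob T" and Z: "Z \<in> Ob T" using zero_object_Ob[OF z] arrD(1)[OF v] by auto
  obtain g h where d: "dist T Z Z C v g h" using c by (auto simp: is_cone_def)
  note D = dist_arr[OF d]
  obtain S where S: "is_biprod T Z O0 S" using biprod_exists[OF Z o] by blast
  note B = biprod_arr[OF S] biprod_simps[OF S]
  have C: "C \<in> Ob T" by (rule arrD(2)[OF D(2)])
  let ?u = "zero_mor Z O0"
  have u: "arr Z O0 ?u" by (rule arr_zero[OF Z o])
  have "dist T Z (sum_ob S) C (col_mor T Z S v ?u) (g \<bullet> pr1 S) h"
  proof (rule TR1_iso[OF d is_iso_ident[OF Z] biprod_zero_iso(1)[OF S z] is_iso_ident[OF C]])
    show "col_mor T Z S v ?u \<in> mor T Z (sum_ob S)" using arr_col[OF S v u] by (simp add: arr_def)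
    show "g \<bullet> pr1 S \<in> mor T (sum_ob S) C" using arr_comp[OF B(3) D(2)] by (simp add: arr_def)
    show "h \<in> mor T C (sh T Z)" using D by (simp add: arr_def)
    show "in1 S \<bullet> v = col_mor T Z S v ?u \<bullet> ident T Z"
      unfolding comp_ident(2)[OF arr_col[OF S v u]] unfolding col_mor_def
      using comp_zero_right[OF Z B(2)] add_zero(1)[OF arr_comp[OF v B(1)]] by simp
    show "ident T C \<bullet> g = (g \<bullet> pr1 S) \<bullet> in1 S"
      using comp_ident[OF D(2)] arr_assoc[OF B(1) B(3) D(2)] B(5) by simp
    show "shm T (ident T Z) \<bullet> h = h \<bullet> ident T C" using comp_ident[OF D(3)] shm_ident[OF Z] by simp
  qed
  then show "le_left T O0 C" "nilpotent_endo T Z v \<Longrightarrow> le_nil_left T O0 C"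
    unfolding le_left_def le_nil_left_def using S arrD(3)[OF u] arrD(3)[OF v] by blast+
qed

lemma le_right_zero_if_cocone:
  assumes z: "zero_object T O0" and d: "dist T C Z Z s v h"
  shows "le_right T O0 C" "nilpotent_endo T Z v \<Longrightarrow> le_nil_right T O0 C"
proof -
  note D = dist_arr[OF d]
  have o: "O0 \<in> Ob T" and Z: "Z \<in> Ob T" and C: "C \<in> Ob T"
    using zero_object_Ob[OF z] D by (auto simp: arr_def)
  obtain S where S: "is_biprod T Z O0 S" using biprod_exists[OF Z o] by blast
  note B = biprod_arr[OF S] biprod_simps[OF S]
  let ?u = "zero_mor O0 Z"
  have u: "arr O0 Z ?u" by (rule arr_zero[OF o Z])
  have "dist T C (sum_ob S) Z (in1 S \<bullet> s) (row_mor T S Z v ?u) h"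
  proof (rule TR1_iso[OF d is_iso_ident[OF C] biprod_zero_iso(1)[OF S z] is_iso_ident[OF Z]])
    show "row_mor T S Z v ?u \<in> mor T (sum_ob S) Z" using arr_row[OF S D(2) u] by (simp add: arr_def)
    show "in1 S \<bullet> s \<in> mor T C (sum_ob S)" using arr_comp[OF D(1) B(1)] by (simp add: arr_def)
    show "h \<in> mor T Z (sh T C)" using D by (simp add: arr_def)
    show "in1 S \<bullet> s = (in1 S \<bullet> s) \<bullet> ident T C" using comp_ident[OF arr_comp[OF D(1) B(1)]] by simp
    show "ident T Z \<bullet> v = row_mor T S Z v ?u \<bullet> in1 S"
      using comp_ident[OF D(2)] row_in(1)[OF S D(2) u] by simp
    show "shm T (ident T C) \<bullet> h = h \<bullet> ident T Z" using comp_ident[OF D(3)] shm_ident[OF C] by simp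
  qed
  then show "le_right T O0 C" "nilpotent_endo T Z v \<Longrightarrow> le_nil_right T O0 C"
    unfolding le_right_def le_nil_right_def using S arrD(3)[OF u] arrD(3)[OF D(2)] by blast+
qed

text \<open>Rotating twice exhibits \<open>C\<close> as the first object of a triangle whose middle map is the endomorphism
  \<open>-v[1]\<close> of \<open>Z[1]\<close>, so the witness of the right comparison is \<open>Z[1]\<close> and not \<open>Z\<close>.\<close>

lemma le_right_zero_if_cone:
  assumes z: "zero_object T O0" and v: "arr Z Z v" and c: "is_cone T Z Z v C"
  shows "le_right T O0 C" "nilpotent_endo T Z v \<Longrightarrow> le_nil_right T O0 C"
proof -
  obtain g h where d: "dist T Z Z C v g h" using c by (auto simp: is_cone_def)
  have d': "dist T C (sh T Z) (sh T Z) h (neg_mor (sh T Z) (sh T Z) (shm T v))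
      (neg_mor (sh T Z) (sh T C) (shm T g))"
    by (rule dist_rotate[OF dist_rotate[OF d]])
  show "le_right T O0 C" by (rule le_right_zero_if_cocone(1)[OF z d'])
  show "le_nil_right T O0 C" if "nilpotent_endo T Z v"
    using le_right_zero_if_cocone(2)[OF z d' nilpotent_neg[OF nilpotent_shm]] that sh_closed arrD(1)[OF v]
    by blast
qed

text \<open>The octahedral axiom applied to the factorization of \<open>p\<close> as the inclusion of \<open>M\<close> followed by the
  row \<open>(p t)\<close>.\<close>

lemma cone_of_left_entry:
  assumes S: "is_biprod T M Z S" and u: "arr Z M u" and v: "arr Z Z v"
    and p: "arr M N p" and t: "arr Z N t"
    and d: "dist T Z (sum_ob S) N (col_mor T Z S u v) (row_mor T S N p t) m"
    and c: "is_cone T M N p C"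
  shows "is_cone T Z Z v C"
proof -
  note B = biprod_arr[OF S]
  obtain g h where dp: "dist T M N C p g h" using c by (auto simp: is_cone_def)
  have dp': "dist T M N C (row_mor T S N p t \<bullet> in1 S) g h" using dp row_in(1)[OF S p t] by simp
  let ?col = "col_mor T Z S u v"
  have col: "arr Z (sum_ob S) ?col" by (rule arr_col[OF S u v])
  obtain r s where "dist T Z C (sh T Z) r s
      (shm T (pr2 S) \<bullet> neg_mor (sh T Z) (sh T (sum_ob S)) (shm T ?col))"
    using TR4[OF split_dist[OF S] dist_rotate[OF d] dp'] by blast
  moreover have "shm T (pr2 S) \<bullet> neg_mor (sh T Z) (sh T (sum_ob S)) (shm T ?col)
      = neg_mor (sh T Z) (sh T Z) (shm T v)"
    using comp_neg_right[OF arr_shm[OF col] arr_shm[OF B(4)]] shm_comp_arr[OF col B(4)]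
      pr_col(2)[OF S u v] by simp
  ultimately have "dist T Z Z C v r s" using dist_unrotate[OF _ v] by simp
  then show ?thesis unfolding is_cone_def by blast
qed

text \<open>The octahedral axiom applied to the factorization of \<open>s\<close> as the column \<open>(s, l)\<close> followed by the
  projection to \<open>M\<close>.\<close>

lemma cone_of_right_entry:
  assumes S: "is_biprod T M Z S" and s: "arr N M s" and l: "arr N Z l"
    and u: "arr M Z u" and v: "arr Z Z v"
    and d: "dist T N (sum_ob S) Z (col_mor T N S s l) (row_mor T S Z u v) m"
    and c: "is_cone T N M s C"
  shows "is_cone T Z Z v C"
proof -
  note B = biprod_arr[OF S]
  obtain g h where ds: "dist T N M C s g h" using c by (auto simp: is_cone_def)
  have ds': "dist T N M C (pr1 S \<bullet> col_mor T N S s l) g h" using ds pr_col(1)[OF S s l] by simp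
  let ?row = "row_mor T S Z u v"
  have row: "arr (sum_ob S) Z ?row" by (rule arr_row[OF S u v])
  have sp: "dist T Z (sum_ob S) M (in2 S) (pr1 S) (zero_mor M (sh T Z))"
    using split_dist[OF biprod_swap[OF S]] by simp
  obtain r t where "dist T Z C (sh T Z) r t
      (shm T ?row \<bullet> neg_mor (sh T Z) (sh T (sum_ob S)) (shm T (in2 S)))"
    using TR4[OF d dist_rotate[OF sp] ds'] by blast
  moreover have "shm T ?row \<bullet> neg_mor (sh T Z) (sh T (sum_ob S)) (shm T (in2 S))
      = neg_mor (sh T Z) (sh T Z) (shm T v)"
    using comp_neg_right[OF arr_shm[OF B(2)] arr_shm[OF row]] shm_comp_arr[OF B(2) row]
      row_in(2)[OF S u v] by simp
  ultimately have "dist T Z Z C v r t" using dist_unrotate[OF _ v] by simp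
  then show ?thesis unfolding is_cone_def by blast
qed

section \<open>Homotopy pullbacks and pushouts\<close>

text \<open>Commutativity of the square is automatic: it says that consecutive maps of the triangle compose
  to zero.\<close>

lemma homotopy_cartesianI:
  assumes f: "arr A B f" and g: "arr A C g" and f': "arr C D f'" and g': "arr B D g'"
    and S: "is_biprod T C B S"
    and d: "dist T A (sum_ob S) D (col_mor T A S g (neg_mor A B f)) (row_mor T S D f' g') h"
  shows "homotopy_cartesian T A B C D f g f' g'"
proof -
  have "add_mor A D (f' \<bullet> g) (neg_mor A D (g' \<bullet> f)) = zero_mor A D"
    using dist_comp_zero(1)[OF d] row_col[OF S g arr_neg[OF f] f' g'] comp_neg_right[OF f g'] by simp
  then have "g' \<bullet> f = f' \<bullet> g"
    using eq_if_diff_zero[OF arr_comp[OF g f'] arr_comp[OF f g']] by simp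
  then show ?thesis unfolding homotopy_cartesian_def using assms by (auto simp: arr_def)
qed

lemma homotopy_pullback_exists:
  assumes g': "arr B D g'" and f': "arr C D f'"
  shows "\<exists>A f g. homotopy_pullback T B D C g' f' A f g"
proof -
  obtain S where S: "is_biprod T C B S" using biprod_exists[OF arrD(1)[OF f'] arrD(1)[OF g']] by blast
  note P = biprod_arr[OF S]
  obtain A e h where d: "dist T A (sum_ob S) D e (row_mor T S D f' g') h"
    using cocone_exists[OF arr_row[OF S f' g']] by blast
  have e: "arr A (sum_ob S) e" by (rule dist_arr(1)[OF d])
  have f0: "arr A B (pr2 S \<bullet> e)" by (rule arr_comp[OF e P(4)])
  have "homotopy_cartesian T A B C D (neg_mor A B (pr2 S \<bullet> e)) (pr1 S \<bullet> e) f' g'"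
    by (rule homotopy_cartesianI[OF arr_neg[OF f0] arr_comp[OF e P(3)] f' g' S, of h])
      (use d col_eta[OF S e] neg_neg[OF f0] in simp)
  then show ?thesis unfolding homotopy_pullback_def by blast
qed

lemma homotopy_pushout_exists:
  assumes f: "arr A B f" and g: "arr A C g"
  shows "\<exists>D f' g'. homotopy_pushout T B A C f g D f' g'"
proof -
  obtain S where S: "is_biprod T C B S" using biprod_exists[OF arrD(2)[OF g] arrD(2)[OF f]] by blast
  note P = biprod_arr[OF S]
  let ?col = "col_mor T A S g (neg_mor A B f)"
  obtain D q h where d: "dist T A (sum_ob S) D ?col q h"
    using TR1_cone[of A "sum_ob S" ?col] arr_col[OF S g arr_neg[OF f]] by (auto simp: arr_def)
  have q: "arr (sum_ob S) D q" by (rule dist_arr(2)[OF d])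
  have "homotopy_cartesian T A B C D f g (q \<bullet> in1 S) (q \<bullet> in2 S)"
    by (rule homotopy_cartesianI[OF f g arr_comp[OF P(1) q] arr_comp[OF P(2) q] S, of h])
      (use d row_eta[OF S q] in simp)
  then show ?thesis unfolding homotopy_pushout_def by blast
qed

lemma le_right_if_homotopy_pullback:
  assumes "homotopy_pullback T M Z Z u v N f g"
  shows "le_right T M N" "nilpotent_endo T Z v \<Longrightarrow> le_nil_right T M N"
proof -
  obtain S e h where "is_biprod T Z M S" "u \<in> mor T M Z" "v \<in> mor T Z Z"
    "dist T N (sum_ob S) Z e (row_mor T S Z v u) h"
    using assms unfolding homotopy_pullback_def homotopy_cartesian_def by blast
  then show "le_right T M N" "nilpotent_endo T Z v \<Longrightarrow> le_nil_right T M N"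
    unfolding le_right_def le_nil_right_def by blast+
qed

text \<open>The column of the triangle has entries \<open>v\<close> and \<open>-u\<close>, so the comparison is witnessed by \<open>-u\<close>.\<close>

lemma le_left_if_homotopy_pushout:
  assumes c: "homotopy_pushout T M Z Z u v N f' g'"
  shows "le_left T M N" "nilpotent_endo T Z v \<Longrightarrow> le_nil_left T M N"
proof -
  obtain S h where S: "is_biprod T Z M S" and u: "u \<in> mor T Z M" and v: "v \<in> mor T Z Z"
    and d: "dist T Z (sum_ob S) N (col_mor T Z S v (neg_mor Z M u)) (row_mor T S N f' g') h"
    using c unfolding homotopy_pushout_def homotopy_cartesian_def by blast
  have "neg_mor Z M u \<in> mor T Z M"
    using S u arr_neg[of Z M u] by (simp add: arr_def is_biprod_def)
  then show "le_left T M N" "nilpotent_endo T Z v \<Longrightarrow> le_nil_left T M N"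
    unfolding le_left_def le_nil_left_def using S v d by blast+
qed

end

section \<open>Comparison relations and cones of endomorphisms\<close>

theorem theorem12:
  fixes k :: "('k, 'r) ring_scheme" and T :: "('k, 'o, 'm, 's) tri_cat_scheme"
  assumes "triangulated_kcategory k T"
  shows
    "(\<forall>O0 M N Z S u v \<pi> \<tau> \<mu> C\<^sub>\<pi> C\<^sub>v.
        zero_object T O0 \<and> is_biprod T M Z S \<and>
        u \<in> mor T Z M \<and> v \<in> mor T Z Z \<and> \<pi> \<in> mor T M N \<and> \<tau> \<in> mor T Z N \<and>
        dist T Z (sum_ob S) N (col_mor T Z S u v) (row_mor T S N \<pi> \<tau>) \<mu> \<and>
        is_cone T M N \<pi> C\<^sub>\<pi> \<and> is_cone T Z Z v C\<^sub>v \<longrightarrow>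
          le_left T O0 C\<^sub>\<pi> \<and> isomorphic T C\<^sub>\<pi> C\<^sub>v \<and>
          (nilpotent_endo T Z v \<longrightarrow> le_nil_left T O0 C\<^sub>\<pi>)) \<and>
     (\<forall>O0 M N Z' S \<sigma> l u' v' \<mu>' C\<^sub>\<sigma> C\<^sub>v.
        zero_object T O0 \<and> is_biprod T M Z' S \<and>
        \<sigma> \<in> mor T N M \<and> l \<in> mor T N Z' \<and> u' \<in> mor T M Z' \<and> v' \<in> mor T Z' Z' \<and>
        dist T N (sum_ob S) Z' (col_mor T N S \<sigma> l) (row_mor T S Z' u' v') \<mu>' \<and>
        is_cone T N M \<sigma> C\<^sub>\<sigma> \<and> is_cone T Z' Z' v' C\<^sub>v \<longrightarrow>
          le_right T O0 C\<^sub>\<sigma> \<and> isomorphic T C\<^sub>\<sigma> C\<^sub>v \<and>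
          (nilpotent_endo T Z' v' \<longrightarrow> le_nil_right T O0 C\<^sub>\<sigma>)) \<and>
     (\<forall>Z v C. Z \<in> Ob T \<and> v \<in> mor T Z Z \<and> is_cone T Z Z v C \<longrightarrow>
        (\<forall>M\<in>Ob T. \<forall>u\<in>mor T M Z.
           (\<exists>N f g. homotopy_pullback T M Z Z u v N f g) \<and>
           (\<forall>N f g. homotopy_pullback T M Z Z u v N f g \<longrightarrow>
              le_right T M N \<and> (nilpotent_endo T Z v \<longrightarrow> le_nil_right T M N))) \<and>
        (\<forall>M\<in>Ob T. \<forall>u'\<in>mor T Z M.
           (\<exists>N f' g'. homotopy_pushout T M Z Z u' v N f' g') \<and>
           (\<forall>N f' g'. homotopy_pushout T M Z Z u' v N f' g' \<longrightarrow>
              le_left T M N \<and> (nilpotent_endo T Z v \<longrightarrow> le_nil_left T M N))))"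
proof -
  interpret triangulated_kcategory k T by (rule assms)
  show ?thesis
  proof (intro conjI allI impI ballI; (elim conjE)?)
    fix O0 M N Z S u v \<pi> \<tau> \<mu> C\<^sub>\<pi> C\<^sub>v
    assume z: "zero_object T O0" and S: "is_biprod T M Z S"
      and u: "u \<in> mor T Z M" and v: "v \<in> mor T Z Z" and p: "\<pi> \<in> mor T M N" and t: "\<tau> \<in> mor T Z N"
      and d: "dist T Z (sum_ob S) N (col_mor T Z S u v) (row_mor T S N \<pi> \<tau>) \<mu>"
      and c: "is_cone T M N \<pi> C\<^sub>\<pi>" and cv: "is_cone T Z Z v C\<^sub>v"
    have O: "M \<in> Ob T" "Z \<in> Ob T" "N \<in> Ob T"
      using S dist_typed[OF d] by (auto simp: is_biprod_def)
    have av: "arr Z Z v" using O v by (simp add: arr_def)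
    have cone: "is_cone T Z Z v C\<^sub>\<pi>"
      by (rule cone_of_left_entry[OF S _ _ _ _ d c]) (use O u v p t in \<open>simp_all add: arr_def\<close>)
    show "le_left T O0 C\<^sub>\<pi>" by (rule le_left_zero_if_cone(1)[OF z av cone])
    show "isomorphic T C\<^sub>\<pi> C\<^sub>v" by (rule cone_unique[OF cone cv])
    show "le_nil_left T O0 C\<^sub>\<pi>" if "nilpotent_endo T Z v"
      by (rule le_left_zero_if_cone(2)[OF z av cone that])
  next
    fix O0 M N Z' S \<sigma> l u' v' \<mu>' C\<^sub>\<sigma> C\<^sub>v
    assume z: "zero_object T O0" and S: "is_biprod T M Z' S"
      and s: "\<sigma> \<in> mor T N M" and l: "l \<in> mor T N Z'"
      and u: "u' \<in> mor T M Z'" and v: "v' \<in> mor T Z' Z'"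
      and d: "dist T N (sum_ob S) Z' (col_mor T N S \<sigma> l) (row_mor T S Z' u' v') \<mu>'"
      and c: "is_cone T N M \<sigma> C\<^sub>\<sigma>" and cv: "is_cone T Z' Z' v' C\<^sub>v"
    have O: "M \<in> Ob T" "Z' \<in> Ob T" "N \<in> Ob T"
      using S dist_typed[OF d] by (auto simp: is_biprod_def)
    have av: "arr Z' Z' v'" using O v by (simp add: arr_def)
    have cone: "is_cone T Z' Z' v' C\<^sub>\<sigma>"
      by (rule cone_of_right_entry[OF S _ _ _ _ d c]) (use O u v s l in \<open>simp_all add: arr_def\<close>)
    show "le_right T O0 C\<^sub>\<sigma>" by (rule le_right_zero_if_cone(1)[OF z av cone])
    show "isomorphic T C\<^sub>\<sigma> C\<^sub>v" by (rule cone_unique[OF cone cv])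
    show "le_nil_right T O0 C\<^sub>\<sigma>" if "nilpotent_endo T Z' v'"
      by (rule le_right_zero_if_cone(2)[OF z av cone that])
  next
    fix Z v C M u
    assume "Z \<in> Ob T" "v \<in> mor T Z Z" "M \<in> Ob T" "u \<in> mor T M Z"
    then show "\<exists>N f g. homotopy_pullback T M Z Z u v N f g"
      by (intro homotopy_pullback_exists) (simp_all add: arr_def)
  next
    fix Z v C M u'
    assume "Z \<in> Ob T" "v \<in> mor T Z Z" "M \<in> Ob T" "u' \<in> mor T Z M"
    then show "\<exists>N f' g'. homotopy_pushout T M Z Z u' v N f' g'"
      by (intro homotopy_pushout_exists) (simp_all add: arr_def)
  next
    fix Z v M u N f g
    assume "homotopy_pullback T M Z Z u v N f g"
    then show "le_right T M N" "nilpotent_endo T Z v \<Longrightarrow> le_nil_right T M N"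
      by (rule le_right_if_homotopy_pullback)+
  next
    fix Z v M u' N f' g'
    assume "homotopy_pushout T M Z Z u' v N f' g'"
    then show "le_left T M N" "nilpotent_endo T Z v \<Longrightarrow> le_nil_left T M N"
      by (rule le_left_if_homotopy_pushout)+
  qed
qed

end
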